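(* Let $\bar y\in S(\bar x)$. Then problem (CP$_{FJ}$) is partially calm at $(\bar x,\bar y)$ if and only if problem (CPFJ) is partially calm at $(\bar x,\bar y,\bar u_0,\bar u)$ for each FJ-multiplier $(\bar u_0,\bar u)\in M_{\rm FJ}(\bar x,\bar y)$.
   Context: The functions $F,f:\mathbb{R}^n\times\mathbb{R}^m\to\mathbb{R}$, $G:\mathbb{R}^n\times\mathbb{R}^m\to\mathbb{R}^q$, $g:\mathbb{R}^n\times\mathbb{R}^m\to\mathbb{R}^p$ are continuously differentiable. The lower level program is $L(x)$: $\min_y f(x,y)$ s.t. $g(x,y)\le 0$; $Y(x):=\{y: g(x,y)\le0\}$; $S(x)$ is its set of global minimizers; $V(x):=\inf_y\{f(x,y): g(x,y)\le0\}$. The bilevel program is $\min_{x,y}F(x,y)$ s.t. $y\in S(x)$, $G(x,y)\le0$. Write $u\nabla_yg:=\sum_{i=1}^pu_i\nabla_yg_i$. $\Sigma_{FJ}$ is the set of $(x,y)$ with $y\in Y(x)$ for which there is $(u_0,u)\neq0$, $(u_0,u)\ge0$, with $u_0\nabla_yf(x,y)+\sum_{j: g_j(x,y)=0}u_j\nabla_yg_j(x,y)=0$. The set of FJ-multipliers is $$M_{\rm FJ}(x,y):=\{(u_0,u)\in\mathbb{R}^{1+p}: u_0\nabla_yf(x,y)+u\nabla_yg(x,y)=0,\ (u_0,u)\ge0,\ \|(u_0,u)\|_1=1,\ u^Tg(x,y)=0\}.$$ (CP$_{FJ}$) is: $\min_{x,y}F(x,y)$ s.t. $f(x,y)-V(x)\le0$,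 $(x,y)\in\Sigma_{FJ}$, $G(x,y)\le0$. It is partially calm at a feasible point $(\bar x,\bar y)$ if there is $\mu\ge0$ such that $(\bar x,\bar y)$ is a local solution of $\min_{x,y}F(x,y)+\mu(f(x,y)-V(x))$ s.t. $(x,y)\in\Sigma_{FJ}$, $G(x,y)\le0$. (CPFJ) is: $\min_{x,y,u_0,u}F(x,y)$ s.t. $f(x,y)-V(x)\le0$, $u_0\nabla_yf(x,y)+u\nabla_yg(x,y)=0$, $g(x,y)\le0$, $(u_0,u)\ge0$, $u^Tg(x,y)=0$, $\|(u_0,u)\|_1=1$, $G(x,y)\le0$. It is partially calm at a feasible point $(\bar x,\bar y,\bar u_0,\bar u)$ if there is $\mu\ge0$ such that this point is a local solution of the problem obtained by deleting the constraint $f(x,y)-V(x)\le0$ and replacing the objective by $F(x,y)+\mu(f(x,y)-V(x))$. (A local solution is in particular feasible.) *)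

theory Defs
  imports "HOL-Analysis.Analysis"
begin

definition cont_differentiable ::
    "('a::real_normed_vector \<Rightarrow> 'b::real_normed_vector) \<Rightarrow> bool" where
  "cont_differentiable h \<longleftrightarrow>
     (\<exists>h'. (\<forall>z. (h has_derivative blinfun_apply (h' z)) (at z)) \<and> continuous_on UNIV h')"

definition grad_y ::
    "((real^'n) \<times> (real^'m) \<Rightarrow> real) \<Rightarrow> (real^'n) \<Rightarrow> (real^'m) \<Rightarrow> (real^'m)" where
  "grad_y h x y = (THE d. GDERIV (\<lambda>y'. h (x, y')) y :> d)"

text \<open>The lower level program. The order on \<^typ>\<open>real^'p\<close> is componentwise. The value
  function is extended-real-valued, since the infimum may be \<open>-\<infinity>\<close>
  (and is \<open>\<infinity>\<close> where the lower level is infeasible).\<close>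

definition lower_feasible ::
    "((real^'n) \<times> (real^'m) \<Rightarrow> (real^'p)) \<Rightarrow> (real^'n) \<Rightarrow> (real^'m) set" where
  "lower_feasible g x = {y. g (x, y) \<le> 0}"

definition lower_solutions ::
    "((real^'n) \<times> (real^'m) \<Rightarrow> real) \<Rightarrow> ((real^'n) \<times> (real^'m) \<Rightarrow> (real^'p)) \<Rightarrow> (real^'n) \<Rightarrow> (real^'m) set" where
  "lower_solutions f g x =
     {y \<in> lower_feasible g x. \<forall>y' \<in> lower_feasible g x. f (x, y) \<le> f (x, y')}"

definition value_fun ::
    "((real^'n) \<times> (real^'m) \<Rightarrow> real) \<Rightarrow> ((real^'n) \<times> (real^'m) \<Rightarrow> (real^'p)) \<Rightarrow> (real^'n) \<Rightarrow> ereal" where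
  "value_fun f g x = (INF y \<in> lower_feasible g x. ereal (f (x, y)))"

text \<open>The multipliers in the next definition are indexed by the active constraints only; they are
  encoded as vectors of \<^typ>\<open>real^'p\<close> vanishing at the inactive indices. Without this clause
  a vector supported on inactive indices would satisfy the remaining conditions trivially.\<close>

definition Sigma_FJ ::
    "((real^'n) \<times> (real^'m) \<Rightarrow> real) \<Rightarrow> ((real^'n) \<times> (real^'m) \<Rightarrow> (real^'p)) \<Rightarrow> ((real^'n) \<times> (real^'m)) set" where
  "Sigma_FJ f g = {(x, y). y \<in> lower_feasible g x \<and>
     (\<exists>(u0::real) (u::(real^'p)). (u0, u) \<noteq> 0 \<and> 0 \<le> u0 \<and> 0 \<le> u \<and>
        (\<forall>j. g (x, y) $ j \<noteq> 0 \<longrightarrow> u $ j = 0) \<and>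
        u0 *\<^sub>R grad_y f x y
          + (\<Sum>j\<in>{j. g (x, y) $ j = 0}. u $ j *\<^sub>R grad_y (\<lambda>z. g z $ j) x y) = 0)}"

definition M_FJ ::
    "((real^'n) \<times> (real^'m) \<Rightarrow> real) \<Rightarrow> ((real^'n) \<times> (real^'m) \<Rightarrow> (real^'p)) \<Rightarrow>
     (real^'n) \<Rightarrow> (real^'m) \<Rightarrow> (real \<times> (real^'p)) set" where
  "M_FJ f g x y = {(u0, u).
     u0 *\<^sub>R grad_y f x y + (\<Sum>j\<in>UNIV. u $ j *\<^sub>R grad_y (\<lambda>z. g z $ j) x y) = 0 \<and>
     0 \<le> u0 \<and> 0 \<le> u \<and>
     \<bar>u0\<bar> + (\<Sum>j\<in>UNIV. \<bar>u $ j\<bar>) = 1 \<and>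
     u \<bullet> g (x, y) = 0}"

definition local_solution ::
    "('z::metric_space \<Rightarrow> ereal) \<Rightarrow> 'z set \<Rightarrow> 'z \<Rightarrow> bool" where
  "local_solution \<phi> A z \<longleftrightarrow> z \<in> A \<and> (\<exists>\<epsilon>>0. \<forall>w \<in> A \<inter> ball z \<epsilon>. \<phi> z \<le> \<phi> w)"

text \<open>Where \<open>V(x) = -\<infinity>\<close> the penalty is \<open>\<infinity>\<close> if \<open>\<mu> > 0\<close>; for \<open>\<mu> = 0\<close> it is \<open>0\<close>, because
  \<open>0 * \<infinity> = 0\<close> in \<^typ>\<open>ereal\<close>.\<close>

definition penalized ::
    "((real^'n) \<times> (real^'m) \<Rightarrow> real) \<Rightarrow> ((real^'n) \<times> (real^'m) \<Rightarrow> real) \<Rightarrow>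
     ((real^'n) \<times> (real^'m) \<Rightarrow> (real^'p)) \<Rightarrow> real \<Rightarrow> (real^'n) \<times> (real^'m) \<Rightarrow> ereal" where
  "penalized F f g \<mu> z = ereal (F z) + ereal \<mu> * (ereal (f z) - value_fun f g (fst z))"

text \<open>Both combined programs have a short form over \<open>(x, y)\<close> (suffix \<open>xy\<close>) and a form with the
  multipliers as additional variables (suffix \<open>xyu\<close>). The relaxed feasible sets omit the constraint
  \<open>f(x, y) - V(x) \<le> 0\<close>.\<close>

definition relaxed_xy ::
    "((real^'n) \<times> (real^'m) \<Rightarrow> real) \<Rightarrow> ((real^'n) \<times> (real^'m) \<Rightarrow> (real^'q)) \<Rightarrow>
     ((real^'n) \<times> (real^'m) \<Rightarrow> (real^'p)) \<Rightarrow> ((real^'n) \<times> (real^'m)) set" where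
  "relaxed_xy f G g = {z. z \<in> Sigma_FJ f g \<and> G z \<le> 0}"

definition feasible_xy ::
    "((real^'n) \<times> (real^'m) \<Rightarrow> real) \<Rightarrow> ((real^'n) \<times> (real^'m) \<Rightarrow> (real^'q)) \<Rightarrow>
     ((real^'n) \<times> (real^'m) \<Rightarrow> (real^'p)) \<Rightarrow> ((real^'n) \<times> (real^'m)) set" where
  "feasible_xy f G g = {(x, y). ereal (f (x, y)) - value_fun f g x \<le> 0 \<and> (x, y) \<in> relaxed_xy f G g}"

definition partially_calm_xy ::
    "((real^'n) \<times> (real^'m) \<Rightarrow> real) \<Rightarrow> ((real^'n) \<times> (real^'m) \<Rightarrow> real) \<Rightarrow>
     ((real^'n) \<times> (real^'m) \<Rightarrow> (real^'q)) \<Rightarrow> ((real^'n) \<times> (real^'m) \<Rightarrow> (real^'p)) \<Rightarrow>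
     (real^'n) \<times> (real^'m) \<Rightarrow> bool" where
  "partially_calm_xy F f G g z \<longleftrightarrow> z \<in> feasible_xy f G g \<and>
     (\<exists>\<mu>\<ge>0. local_solution (penalized F f g \<mu>) (relaxed_xy f G g) z)"

definition relaxed_xyu ::
    "((real^'n) \<times> (real^'m) \<Rightarrow> real) \<Rightarrow> ((real^'n) \<times> (real^'m) \<Rightarrow> (real^'q)) \<Rightarrow>
     ((real^'n) \<times> (real^'m) \<Rightarrow> (real^'p)) \<Rightarrow> ((real^'n) \<times> (real^'m) \<times> real \<times> (real^'p)) set" where
  "relaxed_xyu f G g = {(x, y, u0, u).
     u0 *\<^sub>R grad_y f x y + (\<Sum>j\<in>UNIV. u $ j *\<^sub>R grad_y (\<lambda>z. g z $ j) x y) = 0 \<and>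
     g (x, y) \<le> 0 \<and>
     0 \<le> u0 \<and> 0 \<le> u \<and>
     u \<bullet> g (x, y) = 0 \<and>
     \<bar>u0\<bar> + (\<Sum>j\<in>UNIV. \<bar>u $ j\<bar>) = 1 \<and>
     G (x, y) \<le> 0}"

definition feasible_xyu ::
    "((real^'n) \<times> (real^'m) \<Rightarrow> real) \<Rightarrow> ((real^'n) \<times> (real^'m) \<Rightarrow> (real^'q)) \<Rightarrow>
     ((real^'n) \<times> (real^'m) \<Rightarrow> (real^'p)) \<Rightarrow> ((real^'n) \<times> (real^'m) \<times> real \<times> (real^'p)) set" where
  "feasible_xyu f G g = {(x, y, u0, u).
     ereal (f (x, y)) - value_fun f g x \<le> 0 \<and> (x, y, u0, u) \<in> relaxed_xyu f G g}"

definition partially_calm_xyu ::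
    "((real^'n) \<times> (real^'m) \<Rightarrow> real) \<Rightarrow> ((real^'n) \<times> (real^'m) \<Rightarrow> real) \<Rightarrow>
     ((real^'n) \<times> (real^'m) \<Rightarrow> (real^'q)) \<Rightarrow> ((real^'n) \<times> (real^'m) \<Rightarrow> (real^'p)) \<Rightarrow>
     (real^'n) \<times> (real^'m) \<times> real \<times> (real^'p) \<Rightarrow> bool" where
  "partially_calm_xyu F f G g w \<longleftrightarrow> w \<in> feasible_xyu f G g \<and>
     (\<exists>\<mu>\<ge>0. local_solution (\<lambda>(x, y, u0, u). penalized F f g \<mu> (x, y)) (relaxed_xyu f G g) w)"

end

theory Submission
  imports Defs
begin

text \<open>The partial gradients are continuous, so multipliers of points approaching
  \<open>(xbar, ybar)\<close>, which lie in a simplex, accumulate at multipliers of \<open>(xbar, ybar)\<close>.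
  If (CP$_{FJ}$) were not partially calm, points violating calmness for \<open>\<mu> = k\<close> at radius
  \<open>1 / (k + 1)\<close>, together with their multipliers, would thus violate the calmness of (CPFJ) at
  such an accumulation point, since the penalty grows with \<open>\<mu>\<close>. A multiplier of
  \<open>(xbar, ybar)\<close> exists at all by the Fritz John theorem, so that the right-hand side is
  not vacuous. Conversely, calmness of (CP$_{FJ}$) passes to (CPFJ) because projecting out the
  multipliers maps the feasible set into the feasible set and does not increase distances.\<close>

section \<open>Partial gradients\<close>

text \<open>Composing with the fixed operator \<open>Blinfun L\<close> is continuous on bounded
  linear maps, so continuity of the derivative is inherited. This serves for the components of
  \<open>g\<close>.\<close>

lemma cont_differentiable_bounded_linear:
  assumes "bounded_linear L" and "cont_differentiable h"
  shows "cont_differentiable (\<lambda>z. L (h z))"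
proof -
  obtain h' where h': "\<And>z. (h has_derivative blinfun_apply (h' z)) (at z)"
    and cont: "continuous_on UNIV h'"
    using assms(2) unfolding cont_differentiable_def by auto
  have "((\<lambda>z. L (h z)) has_derivative blinfun_apply (Blinfun L o\<^sub>L h' z)) (at z)" for z
    using bounded_linear.has_derivative[OF assms(1) h'[of z]]
    by (simp add: bounded_linear_Blinfun_apply[OF assms(1)] blinfun_compose.rep_eq o_def)
  moreover have "continuous_on UNIV (\<lambda>z. Blinfun L o\<^sub>L h' z)"
    using cont by (intro continuous_intros)
  ultimately show ?thesis
    unfolding cont_differentiable_def by (intro exI[of _ "\<lambda>z. Blinfun L o\<^sub>L h' z"]) simp
qed

lemma cont_differentiable_vec_nth:
  "cont_differentiable h \<Longrightarrow> cont_differentiable (\<lambda>z. h z $ j)"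
  by (rule cont_differentiable_bounded_linear[OF bounded_linear_vec_nth])

lemma cont_differentiable_imp_continuous_on:
  assumes "cont_differentiable h"
  shows "continuous_on A h"
  using assms has_derivative_continuous unfolding cont_differentiable_def
  by (intro continuous_at_imp_continuous_on) blast

text \<open>The total derivative, restricted to directions \<open>(0, d)\<close>, is a linear form
  in \<open>d\<close>; expanding \<open>d\<close> in the basis gives the vector representing it. The
  explicit formula makes the dependence on the base point visible.\<close>

lemma GDERIV_partial:
  fixes h :: "(real^'n) \<times> (real^'m) \<Rightarrow> real"
  assumes "(h has_derivative blinfun_apply A) (at (x, y))"
  shows "GDERIV (\<lambda>y'. h (x, y')) y :> (\<Sum>b\<in>Basis. blinfun_apply A (0, b) *\<^sub>R b)"
proof -
  have "((\<lambda>y'. h (x, y')) has_derivative (\<lambda>d. blinfun_apply A (0, d))) (at y)"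
  proof -
    have "((\<lambda>y'. (x, y')) has_derivative (\<lambda>d. (0, d))) (at y)"
      by (auto intro!: derivative_eq_intros)
    from has_derivative_compose[OF this assms] show ?thesis
      by simp
  qed
  moreover have "blinfun_apply A (0, d) = inner d (\<Sum>b\<in>Basis. blinfun_apply A (0, b) *\<^sub>R b)" for d
  proof -
    have "(0, d) = (\<Sum>b\<in>Basis. inner d b *\<^sub>R ((0::real^'n), b))"
      by (simp add: prod_eq_iff fst_sum snd_sum euclidean_representation)
    then have "blinfun_apply A (0, d) = blinfun_apply A (\<Sum>b\<in>Basis. inner d b *\<^sub>R (0, b))"
      by simp
    also have "\<dots> = (\<Sum>b\<in>Basis. inner d b * blinfun_apply A (0, b))"
      by (simp only: blinfun.sum_right blinfun.scaleR_right real_scaleR_def)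
    finally show ?thesis
      by (simp add: inner_sum_right mult.commute)
  qed
  ultimately show ?thesis
    unfolding gderiv_def by (rule has_derivative_eq_rhs[OF _ ext])
qed

lemma GDERIV_unique:
  assumes "GDERIV h x :> D" and "GDERIV h x :> E"
  shows "D = E"
proof -
  have "(\<lambda>d. inner d D) = (\<lambda>d. inner d E)"
    using assms unfolding gderiv_def by (rule has_derivative_unique)
  then show ?thesis
    by (metis vector_eq_ldot)
qed

lemma grad_y_eqI: "GDERIV (\<lambda>y'. h (x, y')) y :> D \<Longrightarrow> grad_y h x y = D"
  unfolding grad_y_def using GDERIV_unique by blast

lemma GDERIV_grad_y:
  assumes "cont_differentiable h"
  shows "GDERIV (\<lambda>y'. h (x, y')) y :> grad_y h x y"
proof -
  obtain h' where "\<And>z. (h has_derivative blinfun_apply (h' z)) (at z)"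
    using assms unfolding cont_differentiable_def by auto
  then have D: "GDERIV (\<lambda>y'. h (x, y')) y :> (\<Sum>b\<in>Basis. blinfun_apply (h' (x, y)) (0, b) *\<^sub>R b)"
    by (rule GDERIV_partial)
  show ?thesis
    unfolding grad_y_eqI[OF D] by (rule D)
qed

text \<open>Joint continuity, since both \<open>x\<close> and \<open>y\<close> vary along the
  sequences considered later. It can be read off from the basis formula for the gradient, in which
  only the continuous \<open>h'\<close> depends on the point.\<close>

lemma continuous_grad_y:
  fixes h :: "(real^'n) \<times> (real^'m) \<Rightarrow> real"
  assumes "cont_differentiable h"
  shows "continuous_on UNIV (\<lambda>z. grad_y h (fst z) (snd z))"
proof -
  obtain h' where h': "\<And>z. (h has_derivative blinfun_apply (h' z)) (at z)"
    and cont: "continuous_on UNIV h'"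
    using assms unfolding cont_differentiable_def by auto
  have "grad_y h (fst z) (snd z) = (\<Sum>b\<in>Basis. blinfun_apply (h' z) (0, b) *\<^sub>R b)" for z
    using h'[of z] by (intro grad_y_eqI GDERIV_partial) simp
  moreover have "continuous_on UNIV (\<lambda>z. \<Sum>b\<in>Basis. blinfun_apply (h' z) (0, b) *\<^sub>R (b :: real^'m))"
    using cont by (intro continuous_intros)
  ultimately show ?thesis
    by simp
qed

lemma tendsto_grad_y:
  assumes "cont_differentiable h" and "(X \<longlongrightarrow> x) K" and "(Y \<longlongrightarrow> y) K"
  shows "((\<lambda>k. grad_y h (X k) (Y k)) \<longlongrightarrow> grad_y h x y) K"
proof -
  have "((\<lambda>k. grad_y h (fst (X k, Y k)) (snd (X k, Y k))) \<longlongrightarrow> grad_y h (fst (x, y)) (snd (x, y))) K"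
    by (rule continuous_on_tendsto_compose[OF continuous_grad_y[OF assms(1)]
          tendsto_Pair[OF assms(2,3)]]) simp_all
  then show ?thesis
    by simp
qed

text \<open>Along the ray the derivative at 0 is \<open>inner d D\<close>, by the chain rule. The
  eventual form allows finitely many such statements to be combined at a common step length.\<close>

lemma GDERIV_descent:
  assumes D: "GDERIV h y :> D" and neg: "inner d D < 0"
  shows "\<forall>\<^sub>F t in at_right 0. h (y + t *\<^sub>R d) < h y"
proof -
  have "((\<lambda>t. y + t *\<^sub>R d) has_derivative (\<lambda>s. s *\<^sub>R d)) (at 0)"
    by (auto intro!: derivative_eq_intros)
  moreover have "(h has_derivative (\<lambda>v. inner v D)) (at (y + 0 *\<^sub>R d))"
    using D by (simp add: gderiv_def)
  ultimately have "((\<lambda>t. h (y + t *\<^sub>R d)) has_derivative (\<lambda>s. inner (s *\<^sub>R d) D)) (at 0)"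
    by (rule has_derivative_compose)
  moreover have "(\<lambda>s. inner (s *\<^sub>R d) D) = (*) (inner d D)"
    by (simp add: fun_eq_iff mult.commute)
  ultimately have "((\<lambda>t. h (y + t *\<^sub>R d)) has_real_derivative inner d D) (at 0)"
    by (simp add: has_field_derivative_def)
  from DERIV_neg_dec_right[OF this neg]
  obtain \<delta> where "\<delta> > 0" and "\<forall>t>0. t < \<delta> \<longrightarrow> h (y + t *\<^sub>R d) < h y"
    by auto
  then show ?thesis
    unfolding eventually_at_right_field by blast
qed

section \<open>Fritz John multipliers\<close>

text \<open>All summands of the inner product have the same sign, so the sum vanishes only if each
  of them does. This links the condition \<open>u \<bullet> g (x, y) = 0\<close> to multipliers
  supported on the active indices.\<close>

lemma nonpos_complementarity_iff:
  fixes u v :: "real^'p"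
  assumes "0 \<le> u" and "v \<le> 0"
  shows "inner u v = 0 \<longleftrightarrow> (\<forall>j. v $ j \<noteq> 0 \<longrightarrow> u $ j = 0)"
proof -
  have "\<forall>j. 0 \<le> - (u $ j * v $ j)"
    using assms by (simp add: less_eq_vec_def mult_nonneg_nonpos)
  moreover have "inner u v = 0 \<longleftrightarrow> (\<Sum>j\<in>UNIV. - (u $ j * v $ j)) = 0"
    by (simp add: inner_vec_def sum_negf)
  ultimately have "inner u v = 0 \<longleftrightarrow> (\<forall>j. - (u $ j * v $ j) = 0)"
    by (simp add: sum_nonneg_eq_0_iff del: neg_equal_0_iff_equal mult_eq_0_iff)
  then show ?thesis
    by auto
qed

text \<open>Fritz John by separation: without a multiplier, 0 lies outside the convex hull of the
  gradients of the objective and of the active constraints. A separating hyperplane then yields a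
  direction \<open>- a\<close> of descent for all of them, and a short step along it contradicts the
  minimality of \<open>y\<close>.\<close>

lemma M_FJ_nonempty:
  fixes f :: "(real^'n) \<times> (real^'m) \<Rightarrow> real" and g :: "(real^'n) \<times> (real^'m) \<Rightarrow> (real^'p)"
  assumes f: "cont_differentiable f" and g: "cont_differentiable g"
    and sol: "y \<in> lower_solutions f g x"
  shows "\<exists>u0 u. (u0, u) \<in> M_FJ f g x y"
proof (rule ccontr)
  assume none: "\<nexists>u0 u. (u0, u) \<in> M_FJ f g x y"
  define \<phi> where
    "\<phi> = (\<lambda>(u0, u :: real^'p). u0 *\<^sub>R grad_y f x y + (\<Sum>j\<in>UNIV. u $ j *\<^sub>R grad_y (\<lambda>z. g z $ j) x y))"
  \<comment> \<open>The weights form a simplex on the objective and the active indices, so that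
    \<open>\<phi>\<close> composed with them runs through the convex hull of the gradients.
    Compactness and convexity of the hull come from those of \<open>T\<close>.\<close>
  define T where "T = {(u0::real, u :: real^'p). 0 \<le> u0 \<and> (\<forall>j. 0 \<le> u $ j) \<and>
    u0 + (\<Sum>j\<in>UNIV. u $ j) = 1 \<and> (\<forall>j. g (x, y) $ j \<noteq> 0 \<longrightarrow> u $ j = 0)}"
  have feas: "g (x, y) \<le> 0" and opt: "\<And>y'. g (x, y') \<le> 0 \<Longrightarrow> f (x, y) \<le> f (x, y')"
    using sol by (auto simp: lower_solutions_def lower_feasible_def)
  have "linear \<phi>"
    by (rule linearI)
      (auto simp: \<phi>_def algebra_simps sum.distrib scaleR_sum_right)
  have "convex T"
  proof (rule convexI)
    fix w w' and a b :: real
    assume "w \<in> T" "w' \<in> T" and ab: "0 \<le> a" "0 \<le> b" "a + b = 1"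
    then obtain u0 u v0 v where w: "w = (u0, u)" "w' = (v0, v)"
      and nn: "0 \<le> u0" "0 \<le> v0" "\<And>j. 0 \<le> u $ j" "\<And>j. 0 \<le> v $ j"
      and one: "u0 + (\<Sum>j\<in>UNIV. u $ j) = 1" "v0 + (\<Sum>j\<in>UNIV. v $ j) = 1"
      and compl: "\<And>j. g (x, y) $ j \<noteq> 0 \<Longrightarrow> u $ j = 0 \<and> v $ j = 0"
      by (auto simp: T_def)
    have "a * u0 + b * v0 + (\<Sum>j\<in>UNIV. a * u $ j + b * v $ j)
        = a * (u0 + (\<Sum>j\<in>UNIV. u $ j)) + b * (v0 + (\<Sum>j\<in>UNIV. v $ j))"
      by (simp add: sum.distrib sum_distrib_left algebra_simps)
    then have "a * u0 + b * v0 + (\<Sum>j\<in>UNIV. a * u $ j + b * v $ j) = 1"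
      using one ab(3) by simp
    then show "a *\<^sub>R w + b *\<^sub>R w' \<in> T"
      using nn compl ab by (simp add: T_def w)
  qed
  have "compact T"
  proof -
    have "closed T"
      \<comment> \<open>The premise of the support condition does not depend on the weights, so that
        condition is closed as well.\<close>
      unfolding T_def case_prod_beta
      by (intro closed_Collect_conj closed_Collect_all closed_Collect_imp closed_Collect_le
          closed_Collect_eq continuous_intros open_Collect_const)
    moreover have "bounded T"
    proof (rule boundedI)
      fix w assume "w \<in> T"
      then obtain u0 u where w: "w = (u0, u)" and nn: "0 \<le> u0" "\<forall>j. 0 \<le> u $ j"
        and one: "u0 + (\<Sum>j\<in>UNIV. u $ j) = 1"
        by (auto simp: T_def)
      have "norm w \<le> norm u0 + norm u"
        unfolding w by (rule norm_Pair_le)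
      also have "norm u \<le> (\<Sum>j\<in>UNIV. \<bar>u $ j\<bar>)"
        by (rule norm_le_l1_cart)
      finally show "norm w \<le> 1"
        using nn one by simp
    qed
    ultimately show ?thesis
      by (simp add: compact_eq_bounded_closed)
  qed
  then have "closed (\<phi> ` T)"
    using \<open>linear \<phi>\<close> by (intro compact_imp_closed compact_continuous_image linear_continuous_on
        linear_conv_bounded_linear[THEN iffD1])
  moreover have "convex (\<phi> ` T)"
    using \<open>linear \<phi>\<close> \<open>convex T\<close> by (rule convex_linear_image)
  moreover have "0 \<notin> \<phi> ` T"
  proof
    assume "0 \<in> \<phi> ` T"
    then obtain u0 u where u: "(u0, u) \<in> T" "\<phi> (u0, u) = 0"
      by auto
    moreover have "0 \<le> u"
      using u by (simp add: T_def less_eq_vec_def)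
    ultimately have "(u0, u) \<in> M_FJ f g x y"
      using nonpos_complementarity_iff[OF \<open>0 \<le> u\<close> feas] by (simp add: T_def M_FJ_def \<phi>_def)
    with none show False
      by blast
  qed
  ultimately obtain a b where "0 < b" and "\<forall>v \<in> \<phi> ` T. inner a v > b"
    using separating_hyperplane_closed_0 by metis
  \<comment> \<open>Only the sign of the separation matters from here on. Evaluating it at the
    vertices of \<open>T\<close> recovers the individual gradients.\<close>
  then have sep: "inner (- a) (\<phi> w) < 0" if "w \<in> T" for w
    using that by force
  have "\<forall>\<^sub>F t in at_right 0. f (x, y + t *\<^sub>R (- a)) < f (x, y)"
  proof (rule GDERIV_descent[OF GDERIV_grad_y[OF f]])
    show "inner (- a) (grad_y f x y) < 0"
      using sep[of "(1, 0)"] by (simp add: T_def \<phi>_def)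
  qed
  \<comment> \<open>Active constraints decrease from 0 to first order; inactive ones start negative
    and stay so by continuity. Finiteness of the index type gives one range of \<open>t\<close> for
    all.\<close>
  moreover have "\<forall>\<^sub>F t in at_right 0. \<forall>j. g (x, y + t *\<^sub>R (- a)) $ j < 0"
  proof (rule eventually_all_finite)
    fix j
    show "\<forall>\<^sub>F t in at_right 0. g (x, y + t *\<^sub>R (- a)) $ j < 0"
    proof (cases "g (x, y) $ j = 0")
      case True
      have "(0, axis j 1) \<in> T"
        using True by (auto simp: T_def axis_def)
      moreover have "\<phi> (0, axis j 1) = grad_y (\<lambda>z. g z $ j) x y"
        by (simp add: \<phi>_def axis_def if_distrib[of "\<lambda>c. c *\<^sub>R _"] cong: if_cong)
      ultimately have "inner (- a) (grad_y (\<lambda>z. g z $ j) x y) < 0"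
        using sep by metis
      from GDERIV_descent[OF GDERIV_grad_y[OF cont_differentiable_vec_nth[OF g]] this] True
      show ?thesis
        by simp
    next
      case False
      then have "g (x, y) $ j < 0"
        using feas by (simp add: less_eq_vec_def order.strict_iff_order)
      moreover have "((\<lambda>t. g (x, y + t *\<^sub>R (- a)) $ j) \<longlongrightarrow> g (x, y + 0 *\<^sub>R (- a)) $ j) (at_right 0)"
      proof (rule continuous_on_tendsto_compose
          [OF cont_differentiable_imp_continuous_on[OF cont_differentiable_vec_nth[OF g], of UNIV]])
        show "((\<lambda>t. (x, y + t *\<^sub>R (- a))) \<longlongrightarrow> (x, y + 0 *\<^sub>R (- a))) (at_right 0)"
          by (intro tendsto_intros)
      qed auto
      ultimately show ?thesis
        by (simp add: order_tendstoD(2))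
    qed
  qed
  ultimately have "\<forall>\<^sub>F t in at_right (0::real). False"
  proof eventually_elim
    case (elim t)
    then have "g (x, y + t *\<^sub>R (- a)) \<le> 0"
      by (simp add: less_eq_vec_def less_imp_le)
    from opt[OF this] elim show ?case
      by simp
  qed
  then show False
    by simp
qed

section \<open>Projecting out the multipliers\<close>

lemma relaxed_xyu_iff:
  "(x, y, u0, u) \<in> relaxed_xyu f G g \<longleftrightarrow>
     (u0, u) \<in> M_FJ f g x y \<and> y \<in> lower_feasible g x \<and> G (x, y) \<le> 0"
  by (auto simp: relaxed_xyu_def M_FJ_def lower_feasible_def)

text \<open>Stationarity and complementarity are homogeneous in the multiplier, so a nonzero one can
  be scaled to norm 1; conversely norm 1 excludes 0. Summing over the active indices or over all
  gives the same, as the remaining entries vanish.\<close>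

lemma Sigma_FJ_iff:
  fixes f :: "(real^'n) \<times> (real^'m) \<Rightarrow> real" and g :: "(real^'n) \<times> (real^'m) \<Rightarrow> (real^'p)"
  shows "(x, y) \<in> Sigma_FJ f g \<longleftrightarrow> y \<in> lower_feasible g x \<and> (\<exists>u0 u. (u0, u) \<in> M_FJ f g x y)"
proof (cases "y \<in> lower_feasible g x")
  case True
  then have gle: "g (x, y) \<le> 0"
    by (simp add: lower_feasible_def)
  define \<gamma> where "\<gamma> j = grad_y (\<lambda>z. g z $ j) x y" for j
  have sum_active: "(\<Sum>j\<in>{j. g (x, y) $ j = 0}. u $ j *\<^sub>R \<gamma> j) = (\<Sum>j\<in>UNIV. u $ j *\<^sub>R \<gamma> j)"
    if "\<forall>j. g (x, y) $ j \<noteq> 0 \<longrightarrow> u $ j = 0" for u :: "real^'p"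
    using that by (intro sum.mono_neutral_left) auto
  show ?thesis
  proof
    assume "(x, y) \<in> Sigma_FJ f g"
    then obtain u0 and u :: "real^'p" where nz: "(u0, u) \<noteq> 0" and nn: "0 \<le> u0" "0 \<le> u"
      and compl: "\<forall>j. g (x, y) $ j \<noteq> 0 \<longrightarrow> u $ j = 0"
      and stat: "u0 *\<^sub>R grad_y f x y + (\<Sum>j\<in>{j. g (x, y) $ j = 0}. u $ j *\<^sub>R \<gamma> j) = 0"
      unfolding Sigma_FJ_def \<gamma>_def by blast
    \<comment> \<open>By nonnegativity this is the 1-norm of the multiplier, hence positive.\<close>
    define s where "s = u0 + (\<Sum>j\<in>UNIV. u $ j)"
    have nnj: "0 \<le> u $ j" for j
      using nn by (simp add: less_eq_vec_def)
    have "s \<noteq> 0"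
    proof
      assume "s = 0"
      then have "u0 = 0" and "(\<Sum>j\<in>UNIV. u $ j) = 0"
        using nn nnj sum_nonneg[of UNIV "\<lambda>j. u $ j"] unfolding s_def by auto
      then have "\<forall>j. u $ j = 0"
        using nnj by (simp add: sum_nonneg_eq_0_iff)
      with \<open>u0 = 0\<close> nz show False
        by (simp add: vec_eq_iff zero_prod_def)
    qed
    moreover have "s \<ge> 0"
      using nn nnj unfolding s_def by (simp add: sum_nonneg)
    ultimately have "s > 0"
      by simp
    have nn': "0 \<le> u /\<^sub>R s"
      using nnj \<open>s > 0\<close> by (simp add: less_eq_vec_def)
    have "(u0 / s) *\<^sub>R grad_y f x y + (\<Sum>j\<in>UNIV. (u /\<^sub>R s) $ j *\<^sub>R \<gamma> j)
        = (1 / s) *\<^sub>R (u0 *\<^sub>R grad_y f x y + (\<Sum>j\<in>UNIV. u $ j *\<^sub>R \<gamma> j))"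
      by (simp add: scaleR_sum_right scaleR_add_right divide_inverse mult.commute)
    then have "(u0 / s) *\<^sub>R grad_y f x y + (\<Sum>j\<in>UNIV. (u /\<^sub>R s) $ j *\<^sub>R \<gamma> j) = 0"
      using stat sum_active[OF compl] by simp
    moreover have "\<bar>u0 / s\<bar> + (\<Sum>j\<in>UNIV. \<bar>(u /\<^sub>R s) $ j\<bar>) = 1"
    proof -
      have "\<bar>u0 / s\<bar> + (\<Sum>j\<in>UNIV. \<bar>(u /\<^sub>R s) $ j\<bar>) = u0 / s + (\<Sum>j\<in>UNIV. u $ j) / s"
        using nn nnj \<open>s > 0\<close> by (simp add: abs_mult divide_inverse sum_distrib_left mult.commute)
      also have "\<dots> = 1"
        using \<open>s > 0\<close> by (simp add: s_def add_divide_distrib[symmetric])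
      finally show ?thesis .
    qed
    moreover have "inner (u /\<^sub>R s) (g (x, y)) = 0"
      using nonpos_complementarity_iff[OF nn(2) gle] compl by simp
    ultimately have "(u0 / s, u /\<^sub>R s) \<in> M_FJ f g x y"
      using nn nn' \<open>s > 0\<close> by (simp add: M_FJ_def \<gamma>_def)
    with True show "y \<in> lower_feasible g x \<and> (\<exists>u0 u. (u0, u) \<in> M_FJ f g x y)"
      by blast
  next
    assume "y \<in> lower_feasible g x \<and> (\<exists>u0 u. (u0, u) \<in> M_FJ f g x y)"
    then obtain u0 u where M: "(u0, u) \<in> M_FJ f g x y"
      by blast
    then have nn: "0 \<le> u0" "0 \<le> u"
      by (auto simp: M_FJ_def)
    have compl: "\<forall>j. g (x, y) $ j \<noteq> 0 \<longrightarrow> u $ j = 0"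
      using M nonpos_complementarity_iff[OF nn(2) gle] by (simp add: M_FJ_def)
    have "(u0, u) \<noteq> 0"
      using M by (auto simp: M_FJ_def zero_prod_def)
    moreover have "u0 *\<^sub>R grad_y f x y + (\<Sum>j\<in>{j. g (x, y) $ j = 0}. u $ j *\<^sub>R \<gamma> j) = 0"
      using M sum_active[OF compl] by (simp add: M_FJ_def \<gamma>_def)
    ultimately show "(x, y) \<in> Sigma_FJ f g"
      using True nn compl unfolding Sigma_FJ_def \<gamma>_def by blast
  qed
qed (simp add: Sigma_FJ_def)

lemma relaxed_xy_iff: "(x, y) \<in> relaxed_xy f G g \<longleftrightarrow> (\<exists>u0 u. (x, y, u0, u) \<in> relaxed_xyu f G g)"
  by (auto simp: relaxed_xy_def Sigma_FJ_iff relaxed_xyu_iff)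

section \<open>Compactness of multipliers\<close>

lemma M_FJ_norm_le:
  fixes u :: "real^'p"
  assumes "(u0, u) \<in> M_FJ f g x y"
  shows "norm (u0, u) \<le> 1"
  using assms norm_Pair_le[of u0 u] norm_le_l1_cart[of u] by (auto simp: M_FJ_def)

text \<open>The multiplier map has a closed graph: all its conditions are equations or weak
  inequalities between continuous expressions. The normalization passes to the limit too, so the
  limit cannot degenerate to 0.\<close>

lemma M_FJ_limit:
  fixes f :: "(real^'n) \<times> (real^'m) \<Rightarrow> real" and g :: "(real^'n) \<times> (real^'m) \<Rightarrow> (real^'p)"
  assumes f: "cont_differentiable f" and g: "cont_differentiable g"
    and M: "\<And>k. (A k, U k) \<in> M_FJ f g (X k) (Y k)"
    and X: "X \<longlonglongrightarrow> x" and Y: "Y \<longlonglongrightarrow> y" and A: "A \<longlonglongrightarrow> a" and U: "U \<longlonglongrightarrow> u"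
  shows "(a, u) \<in> M_FJ f g x y"
proof -
  have gXY: "(\<lambda>k. g (X k, Y k)) \<longlonglongrightarrow> g (x, y)"
    by (rule continuous_on_tendsto_compose[OF cont_differentiable_imp_continuous_on[OF g, of UNIV]])
      (auto intro: tendsto_Pair X Y)
  have "(\<lambda>k. A k *\<^sub>R grad_y f (X k) (Y k) +
        (\<Sum>j\<in>UNIV. U k $ j *\<^sub>R grad_y (\<lambda>z. g z $ j) (X k) (Y k)))
      \<longlonglongrightarrow> a *\<^sub>R grad_y f x y + (\<Sum>j\<in>UNIV. u $ j *\<^sub>R grad_y (\<lambda>z. g z $ j) x y)"
    by (intro tendsto_intros A U tendsto_grad_y X Y f cont_differentiable_vec_nth g)
  then have "a *\<^sub>R grad_y f x y + (\<Sum>j\<in>UNIV. u $ j *\<^sub>R grad_y (\<lambda>z. g z $ j) x y) = 0"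
    using M by (simp add: M_FJ_def LIMSEQ_const_iff)
  moreover have norm: "\<bar>A k\<bar> + (\<Sum>j\<in>UNIV. \<bar>U k $ j\<bar>) = 1" for k
    using M[of k] by (auto simp: M_FJ_def)
  have "(\<lambda>k. \<bar>A k\<bar> + (\<Sum>j\<in>UNIV. \<bar>U k $ j\<bar>)) \<longlonglongrightarrow> \<bar>a\<bar> + (\<Sum>j\<in>UNIV. \<bar>u $ j\<bar>)"
    by (intro tendsto_intros A U)
  then have "\<bar>a\<bar> + (\<Sum>j\<in>UNIV. \<bar>u $ j\<bar>) = 1"
    unfolding norm by (simp add: LIMSEQ_const_iff)
  moreover have "(\<lambda>k. inner (U k) (g (X k, Y k))) \<longlonglongrightarrow> inner u (g (x, y))"
    by (intro tendsto_intros U gXY)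
  moreover have "0 \<le> a"
    using M by (intro LIMSEQ_le_const[OF A]) (auto simp: M_FJ_def)
  moreover have "0 \<le> u $ j" for j
    using M by (intro LIMSEQ_le_const[OF tendsto_vec_nth[OF U]]) (auto simp: M_FJ_def less_eq_vec_def)
  ultimately show ?thesis
    using M by (simp add: M_FJ_def less_eq_vec_def LIMSEQ_const_iff)
qed

section \<open>Penalties and partial calmness\<close>

lemma value_gap_nonneg:
  assumes "y \<in> lower_feasible g x"
  shows "0 \<le> ereal (f (x, y)) - value_fun f g x"
proof -
  have "value_fun f g x \<le> ereal (f (x, y))"
    unfolding value_fun_def using assms by (rule INF_lower)
  then show ?thesis
    \<comment> \<open>The value \<infinity> is excluded by the upper bound; for -\<infinity> the gap
      is \<infinity>.\<close>
    by (cases "value_fun f g x") auto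
qed

text \<open>The infimum is attained at \<open>y\<close>, hence finite, and the extended-real
  difference is a true cancellation.\<close>

lemma value_gap_solution:
  assumes "y \<in> lower_solutions f g x"
  shows "ereal (f (x, y)) - value_fun f g x = 0"
proof -
  have "value_fun f g x = ereal (f (x, y))"
    using assms unfolding value_fun_def lower_solutions_def
    by (intro antisym INF_lower2[of y] INF_greatest) auto
  then show ?thesis
    by (simp add: zero_ereal_def)
qed

text \<open>The gap multiplying the parameter is nonnegative at lower-level feasible points,
  possibly infinite. This makes violations of calmness for different parameters comparable.\<close>

lemma penalized_mono:
  assumes "y \<in> lower_feasible g x" and "\<mu> \<le> \<nu>"
  shows "penalized F f g \<mu> (x, y) \<le> penalized F f g \<nu> (x, y)"
proof -
  have "ereal \<mu> * (ereal (f (x, y)) - value_fun f g x) \<le> ereal \<nu> * (ereal (f (x, y)) - value_fun f g x)"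
    using assms(2) value_gap_nonneg[OF assms(1)] by (intro ereal_mult_right_mono) simp_all
  then show ?thesis
    unfolding penalized_def fst_conv by (rule add_left_mono)
qed

text \<open>The reference value is thus the same for every penalty parameter.\<close>

lemma penalized_solution:
  assumes "y \<in> lower_solutions f g x"
  shows "penalized F f g \<mu> (x, y) = ereal (F (x, y))"
  using value_gap_solution[OF assms] by (simp add: penalized_def)

text \<open>A ball around a point with multipliers therefore projects into the ball of the same
  radius around \<open>(xbar, ybar)\<close>.\<close>

lemma dist_drop_last:
  fixes v :: "'a::metric_space" and v' :: "'b::metric_space" and v'' :: "'c::metric_space"
  shows "dist (v, v') (w, w') \<le> dist (v, v', v'') (w, w', w'')"
  by (simp add: dist_Pair_Pair)

theorem theorem4p4:
  fixes F f :: "(real^'n) \<times> (real^'m) \<Rightarrow> real"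
    and G :: "(real^'n) \<times> (real^'m) \<Rightarrow> (real^'q)"
    and g :: "(real^'n) \<times> (real^'m) \<Rightarrow> (real^'p)"
    and xbar :: "real^'n" and ybar :: "real^'m"
  assumes "cont_differentiable F" and "cont_differentiable f"
    and "cont_differentiable G" and "cont_differentiable g"
    and "ybar \<in> lower_solutions f g xbar"
  shows "partially_calm_xy F f G g (xbar, ybar) \<longleftrightarrow>
    (\<forall>(u0, u) \<in> M_FJ f g xbar ybar. partially_calm_xyu F f G g (xbar, ybar, u0, u))"
proof
  assume calm: "partially_calm_xy F f G g (xbar, ybar)"
  \<comment> \<open>Parameter and radius are chosen before the multiplier and serve all multipliers
    at once.\<close>
  then obtain \<mu> \<epsilon> where "\<mu> \<ge> 0" "\<epsilon> > 0"
    and min: "\<And>z. z \<in> relaxed_xy f G g \<Longrightarrow> z \<in> ball (xbar, ybar) \<epsilon> \<Longrightarrow>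
      penalized F f g \<mu> (xbar, ybar) \<le> penalized F f g \<mu> z"
    unfolding partially_calm_xy_def local_solution_def by blast
  have feas: "(xbar, ybar) \<in> feasible_xy f G g"
    using calm by (simp add: partially_calm_xy_def)
  show "\<forall>(u0, u) \<in> M_FJ f g xbar ybar. partially_calm_xyu F f G g (xbar, ybar, u0, u)"
  proof clarify
    fix u0 u assume "(u0, u) \<in> M_FJ f g xbar ybar"
    then have rel: "(xbar, ybar, u0, u) \<in> relaxed_xyu f G g"
      and "(xbar, ybar, u0, u) \<in> feasible_xyu f G g"
      using feas by (auto simp: feasible_xy_def feasible_xyu_def relaxed_xyu_iff relaxed_xy_iff)
    moreover have "penalized F f g \<mu> (xbar, ybar) \<le> penalized F f g \<mu> (x, y)"
      if "(x, y, v0, v) \<in> relaxed_xyu f G g"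
        and "(x, y, v0, v) \<in> ball (xbar, ybar, u0, u) \<epsilon>" for x y v0 v
    proof (rule min)
      show "(x, y) \<in> relaxed_xy f G g"
        using that(1) relaxed_xy_iff by blast
      show "(x, y) \<in> ball (xbar, ybar) \<epsilon>"
        using that(2) dist_drop_last[of xbar ybar x y "(u0, u)" "(v0, v)"] by simp
    qed
    then have "local_solution (\<lambda>(x, y, u0, u). penalized F f g \<mu> (x, y))
        (relaxed_xyu f G g) (xbar, ybar, u0, u)"
      unfolding local_solution_def using rel \<open>\<epsilon> > 0\<close> by (intro conjI exI[of _ \<epsilon>]) auto
    ultimately show "partially_calm_xyu F f G g (xbar, ybar, u0, u)"
      unfolding partially_calm_xyu_def using \<open>\<mu> \<ge> 0\<close> by blast
  qed
next
  assume calm: "\<forall>(u0, u) \<in> M_FJ f g xbar ybar. partially_calm_xyu F f G g (xbar, ybar, u0, u)"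
  \<comment> \<open>Calmness includes feasibility, and \<open>G (xbar, ybar) \<le> 0\<close> is read
    off from calmness at this one multiplier.\<close>
  obtain v0 v where "(v0, v) \<in> M_FJ f g xbar ybar"
    using M_FJ_nonempty[OF assms(2,4,5)] by blast
  then have "(xbar, ybar, v0, v) \<in> feasible_xyu f G g"
    using calm by (auto simp: partially_calm_xyu_def)
  then have feas: "(xbar, ybar) \<in> feasible_xy f G g"
    by (auto simp: feasible_xy_def feasible_xyu_def relaxed_xy_iff)
  then have rel: "(xbar, ybar) \<in> relaxed_xy f G g"
    by (simp add: feasible_xy_def)
  show "partially_calm_xy F f G g (xbar, ybar)"
  proof (rule ccontr)
    assume not_calm: "\<not> partially_calm_xy F f G g (xbar, ybar)"
    \<comment> \<open>Failure of calmness is used with parameter \<open>k\<close> and radius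
      1/(k+1), positive also for \<open>k = 0\<close>. The penalty vanishes at the solution, which
      leaves \<open>F (xbar, ybar)\<close> on the right.\<close>
    have "\<exists>x y a u. (x, y, a, u) \<in> relaxed_xyu f G g \<and>
        dist (xbar, ybar) (x, y) < inverse (real (Suc k)) \<and>
        penalized F f g (real k) (x, y) < ereal (F (xbar, ybar))" for k
    proof -
      have "\<not> local_solution (penalized F f g (real k)) (relaxed_xy f G g) (xbar, ybar)"
        using not_calm feas of_nat_0_le_iff unfolding partially_calm_xy_def by blast
      moreover have "inverse (real (Suc k)) > 0"
        by simp
      ultimately obtain z where "z \<in> relaxed_xy f G g \<inter> ball (xbar, ybar) (inverse (real (Suc k)))"
        and "\<not> penalized F f g (real k) (xbar, ybar) \<le> penalized F f g (real k) z"
        using rel unfolding local_solution_def by blast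
      then show ?thesis
        using penalized_solution[OF assms(5)] by (cases z) (auto simp: relaxed_xy_iff not_le)
    qed
    then obtain X Y A U where R: "\<And>k. (X k, Y k, A k, U k) \<in> relaxed_xyu f G g"
      and close: "\<And>k. dist (xbar, ybar) (X k, Y k) < inverse (real (Suc k))"
      and less: "\<And>k. penalized F f g (real k) (X k, Y k) < ereal (F (xbar, ybar))"
      by metis
    have "(\<lambda>k. (X k, Y k)) \<longlonglongrightarrow> (xbar, ybar)"
    proof (rule metric_tendsto_imp_tendsto[OF LIMSEQ_inverse_real_of_nat])
      show "\<forall>\<^sub>F k in sequentially. dist (X k, Y k) (xbar, ybar) \<le> dist (inverse (real (Suc k))) 0"
        using close by (intro always_eventually allI) (simp add: dist_commute less_imp_le)
    qed
    then have X: "X \<longlonglongrightarrow> xbar" and Y: "Y \<longlonglongrightarrow> ybar"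
      using tendsto_fst tendsto_snd by fastforce+
    \<comment> \<open>The points already converge; Bolzano-Weierstrass is applied to the multipliers
      alone.\<close>
    have "bounded (range (\<lambda>k. (A k, U k)))"
      using R by (intro boundedI[of _ 1]) (auto simp: relaxed_xyu_iff intro: M_FJ_norm_le)
    then obtain l r where r: "strict_mono (r :: nat \<Rightarrow> nat)"
      and l: "((\<lambda>k. (A k, U k)) \<circ> r) \<longlonglongrightarrow> l"
      using bounded_imp_convergent_subsequence by blast
    obtain a u where au: "l = (a, u)"
      by (cases l)
    have Ar: "(\<lambda>k. A (r k)) \<longlonglongrightarrow> a" and Ur: "(\<lambda>k. U (r k)) \<longlonglongrightarrow> u"
      using tendsto_fst[OF l] tendsto_snd[OF l] by (simp_all add: au o_def)
    have Xr: "(\<lambda>k. X (r k)) \<longlonglongrightarrow> xbar" and Yr: "(\<lambda>k. Y (r k)) \<longlonglongrightarrow> ybar"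
      using LIMSEQ_subseq_LIMSEQ[OF X r] LIMSEQ_subseq_LIMSEQ[OF Y r] by (simp_all add: o_def)
    \<comment> \<open>Which multiplier arises as the limit is not known in advance, hence calmness
      is assumed at all of them.\<close>
    have "(a, u) \<in> M_FJ f g xbar ybar"
      using R by (intro M_FJ_limit[OF assms(2,4) _ Xr Yr Ar Ur]) (simp add: relaxed_xyu_iff)
    with calm have "partially_calm_xyu F f G g (xbar, ybar, a, u)"
      by blast
    then obtain \<mu> \<epsilon> where "\<epsilon> > 0"
      and min: "\<And>w. w \<in> relaxed_xyu f G g \<inter> ball (xbar, ybar, a, u) \<epsilon> \<Longrightarrow>
        (\<lambda>(x, y, u0, u). penalized F f g \<mu> (x, y)) (xbar, ybar, a, u)
          \<le> (\<lambda>(x, y, u0, u). penalized F f g \<mu> (x, y)) w"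
      unfolding partially_calm_xyu_def local_solution_def by blast
    have "(\<lambda>k. (X (r k), Y (r k), A (r k), U (r k))) \<longlonglongrightarrow> (xbar, ybar, a, u)"
      by (intro tendsto_Pair Xr Yr Ar Ur)
    then have "\<forall>\<^sub>F k in sequentially. dist (X (r k), Y (r k), A (r k), U (r k)) (xbar, ybar, a, u) < \<epsilon>"
      using \<open>\<epsilon> > 0\<close> by (rule tendstoD)
    moreover have "\<forall>\<^sub>F k in sequentially. \<mu> \<le> real k"
      using eventually_ge_at_top[of "nat \<lceil>\<mu>\<rceil>"] by eventually_elim linarith
    ultimately have "\<forall>\<^sub>F k in sequentially. False"
    proof eventually_elim
      case (elim k)
      \<comment> \<open>A strictly increasing \<open>r\<close> satisfies \<open>k \<le> r k\<close>,
        so the growing parameters eventually dominate the fixed \<open>\<mu>\<close> belonging to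
        the limit multiplier.\<close>
      have "\<mu> \<le> real (r k)"
        using elim(2) seq_suble[OF r, of k] by linarith
      have "ereal (F (xbar, ybar)) \<le> penalized F f g \<mu> (X (r k), Y (r k))"
        using min[of "(X (r k), Y (r k), A (r k), U (r k))"] R elim(1) penalized_solution[OF assms(5)]
        by (simp add: dist_commute)
      also have "\<dots> \<le> penalized F f g (real (r k)) (X (r k), Y (r k))"
        using R \<open>\<mu> \<le> real (r k)\<close> by (intro penalized_mono) (simp_all add: relaxed_xyu_iff)
      also have "\<dots> < ereal (F (xbar, ybar))"
        by (rule less)
      finally show ?case
        by simp
    qed
    then show False
      by simp
  qed
qed

end
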